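(* Let $k\ge 1$ and $m\ge 1$ be integers and let $E=\{v_1,\dots,v_N\}\subset\mathbf{R}^m\setminus\{0\}$ be a finite set of (distinct) non-zero vectors such that no pair of vectors from $E$ is collinear. Let $(1/p_j,\lambda_j)_{j=1}^N\in([0,1]\times\mathbf{R})^N$ and suppose there is a finite constant $C$ such that $$\Lambda(f_1,\dots,f_N)\le C\prod_{j=1}^N\|f_j\|_{L^{p_j}_{\lambda_j}}$$ for all non-negative measurable functions $f_1,\dots,f_N$ on $\mathbf{R}^k$. Then \begin{align*} &\text{(i)}\quad \sum_{j=1}^N\Big(\frac1{p_j}+\frac{\lambda_j}{k}\Big)=m;\\ &\text{(ii)}\quad \sum_{j=1}^N\frac1{p_j}\ge 1;\\ &\text{(iii)}\quad \sum_{j:\,v_j\notin V}\lambda_j\ge 0\quad\text{for all subspaces } V\subset\mathbf{R}^m;\\ &\text{(iv)}\quad \sum_{j:\,v_j\notin V}\Big(\frac1{p_j}+\frac{\lambda_j}{k}\Big)\ge m-\dim(V)\quad\text{for all subspaces } V\subset\mathbf{R}^m. \end{align*}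
   Context: For $v=(v^1,\dots,v^m)\in\mathbf{R}^m$ and $x=(x^1,\dots,x^m)\in\mathbf{R}^{mk}$ with each $x^i\in\mathbf{R}^k$, define $v\cdot x=\sum_{i=1}^m v^ix^i\in\mathbf{R}^k$. For non-negative measurable functions $f_1,\dots,f_N$ on $\mathbf{R}^k$, the form $\Lambda$ is $$\Lambda(f_1,\dots,f_N)=\int_{\mathbf{R}^{km}}\prod_{i=1}^N f_i(v_i\cdot x)\,dx\in[0,\infty].$$ The weighted space $L^p_\alpha=L^p_\alpha(\mathbf{R}^k)$ has norm $\|f\|_{L^p_\alpha}=\|\,|\cdot|^\alpha f\|_{L^p(\mathbf{R}^k)}$ (possibly $+\infty$; the convention $0\cdot\infty=0$ is used in products). The value $1/p_j=0$ corresponds to $p_j=\infty$. *)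

theory Defs
  imports "HOL-Analysis.Analysis" "HOL-Probability.Essential_Supremum"
begin

text \<open>The ambient spaces are \<open>real ^ 'k\<close> and \<open>real ^ 'm\<close> with \<open>CARD('k) = k\<close> and \<open>CARD('m) = m\<close>;
  a point \<open>x = (x\<^sup>1, \<dots>, x\<^sup>m)\<close> with all \<open>x\<^sup>i\<close> in \<open>real ^ 'k\<close> has type \<open>(real ^ 'k) ^ 'm\<close>, whose
  \<open>lebesgue\<close> measure is that of the \<open>km\<close>-dimensional Euclidean space.\<close>

definition vec_dot :: "real ^ 'm \<Rightarrow> (real ^ 'k) ^ 'm \<Rightarrow> real ^ 'k" where
  "vec_dot v x = (\<Sum>i\<in>UNIV. (v $ i) *\<^sub>R (x $ i))"

definition Lambda_form ::
  "nat \<Rightarrow> (nat \<Rightarrow> real ^ 'm) \<Rightarrow> (nat \<Rightarrow> real ^ 'k \<Rightarrow> real) \<Rightarrow> ennreal" where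
  "Lambda_form N v f =
     (\<integral>\<^sup>+ x. ennreal (\<Prod>i=1..N. f i (vec_dot (v i) x)) \<partial>(lebesgue :: ((real ^ 'k) ^ 'm) measure))"

text \<open>The \<open>L\<^sup>p\<close> norm of a Lebesgue measurable function for \<open>p\<close> in \<open>[1, \<infinity>]\<close>, with value \<open>\<infinity>\<close> allowed. As \<open>powr\<close>
  is only available for finite arguments, the \<open>p\<close>-th root of an infinite integral is spelled out.\<close>

definition Lp_norm :: "ennreal \<Rightarrow> ('a :: euclidean_space \<Rightarrow> real) \<Rightarrow> ennreal" where
  "Lp_norm p f =
     (if p = \<infinity> then esssup lebesgue (\<lambda>x. ennreal \<bar>f x\<bar>)
      else let I = (\<integral>\<^sup>+ x. ennreal (\<bar>f x\<bar> powr enn2real p) \<partial>lebesgue)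
           in if I = \<infinity> then \<infinity> else ennreal (enn2real I powr (1 / enn2real p)))"

text \<open>Since \<open>0 powr a = 0\<close> for all \<open>a\<close>, the weight vanishes at the origin (also for \<open>a \<le> 0\<close>); this
  affects a null set only.\<close>

definition weighted_Lp_norm :: "ennreal \<Rightarrow> real \<Rightarrow> ('a :: euclidean_space \<Rightarrow> real) \<Rightarrow> ennreal" where
  "weighted_Lp_norm p a f = Lp_norm p (\<lambda>x. norm x powr a * f x)"

end

theory Submission
  imports Defs "HOL-Real_Asymp.Real_Asymp"
begin

text \<open>
  Every condition comes from testing the inequality on functions for which the right-hand side is
  computable and the left-hand side is bounded below by the volume of an explicit set of \<open>x\<close>.
  Indicators of annuli of radius \<open>R\<close> if \<open>v\<^sub>j \<notin> V\<close> and of radius 1 if \<open>v\<^sub>j \<in> V\<close> give (iv) as \<open>R\<close> tends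
  to infinity: starting from a generic point one may move by \<open>O(R)\<close> in the \<open>k(m - dim V)\<close> directions
  orthogonal to \<open>V\<close>. Unit balls at distance \<open>R\<close> from the origin for \<open>v\<^sub>j \<notin> V\<close> give (iii) by
  translation. In (i) one direction is (iv) for \<open>V = {0}\<close>, the other one follows by shrinking all sets.
  For (ii), the functions \<open>|y| powr (- \<lambda>\<^sub>j - k/p\<^sub>j)\<close> are cut off to \<open>M\<close> disjoint scales; by (i) each scale
  contributes the same amount to \<open>\<Lambda>\<close>, while the product of the norms is of order \<open>M powr (\<Sum> 1/p\<^sub>j)\<close>.
\<close>

section \<open>Volumes of balls and the pairing of coefficient vectors with points\<close>

lemma emeasure_lebesgue_ball:
  fixes c :: "'a::euclidean_space"
  assumes "r \<ge> 0"
  shows "emeasure lebesgue (ball c r) = ennreal (unit_ball_vol (DIM('a)) * r ^ DIM('a))"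
    and "emeasure lebesgue (cball c r) = ennreal (unit_ball_vol (DIM('a)) * r ^ DIM('a))"
  using emeasure_ball[OF assms, of c] emeasure_cball[OF assms, of c] by simp_all

lemma linear_vec_dot: "linear (vec_dot u)"
  by (rule linearI) (simp_all add: vec_dot_def scaleR_add_right sum.distrib scaleR_sum_right mult.commute)

text \<open>The argument is the elementary tensor of \<open>w\<close> and \<open>z\<close>. All test
  points below are sums of such tensors, so that \<open>vec_dot\<close> reduces to ordinary inner
  products.\<close>

lemma vec_dot_tensor: "vec_dot u (\<chi> i. (w $ i) *\<^sub>R z) = (u \<bullet> w) *\<^sub>R z"
  by (simp add: vec_dot_def inner_vec_def scaleR_sum_left)

text \<open>Triangle inequality, then Cauchy-Schwarz over the index \<open>i\<close>.\<close>

lemma norm_vec_dot_le: "norm (vec_dot u x) \<le> norm u * norm x"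
proof -
  have "norm (vec_dot u x) \<le> (\<Sum>i\<in>UNIV. norm ((u $ i) *\<^sub>R (x $ i)))"
    unfolding vec_dot_def by (rule norm_sum)
  also have "\<dots> = (\<Sum>i\<in>UNIV. \<bar>norm (u $ i)\<bar> * \<bar>norm (x $ i)\<bar>)" by simp
  also have "\<dots> \<le> norm u * norm x"
    unfolding norm_vec_def by (rule L2_set_mult_ineq)
  finally show ?thesis .
qed

section \<open>Upper bounds for weighted norms\<close>

lemma enn2real_one_divide:
  assumes "p \<noteq> \<infinity>" "1 \<le> p"
  shows "enn2real (1 / p) = 1 / enn2real p" "1 \<le> enn2real p"
proof -
  obtain r where r: "p = ennreal r" "0 \<le> r" using assms by (cases p) auto
  then have "1 \<le> r" using assms by simp
  then show "enn2real (1 / p) = 1 / enn2real p" "1 \<le> enn2real p"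
    using r divide_ennreal[of 1 r] by auto
qed

text \<open>Raising the pointwise bound to the power \<open>p\<close> turns it into a multiple of
  \<open>g\<close>, which is then integrated. Writing the exponent as \<open>1 / p\<close> covers
  \<open>p = \<infinity>\<close> as well: there it is 0, and since \<open>0 powr 0 = 0\<close> the
  power of \<open>g\<close> is at most 1 everywhere.\<close>

lemma weighted_Lp_norm_le:
  fixes f g :: "'a::euclidean_space \<Rightarrow> real"
  assumes p: "1 \<le> p"
    and f: "f \<in> borel_measurable lebesgue" "\<And>y. 0 \<le> f y"
    and g: "g \<in> borel_measurable lebesgue" "\<And>y. 0 \<le> g y"
    and B: "0 \<le> B"
    and le: "\<And>y. norm y powr a * f y \<le> B * g y powr enn2real (1 / p)"
    and I: "0 < I" "(\<integral>\<^sup>+y. ennreal (g y) \<partial>lebesgue) \<le> ennreal I"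
  shows "weighted_Lp_norm p a f \<le> ennreal (B * I powr enn2real (1 / p))"
proof (cases "p = \<infinity>")
  case True
  have [measurable]: "f \<in> borel_measurable lebesgue" by fact
  have [measurable]: "(\<lambda>x::'a. norm x) \<in> borel_measurable lebesgue"
    by (rule measurable_completion) simp
  have B1: "\<bar>norm y powr a * f y\<bar> \<le> B" for y
  proof -
    have "norm y powr a * f y \<le> B * g y powr 0" using le[of y] True by simp
    also have "\<dots> \<le> B * 1" by (rule mult_left_mono) (use B in auto)
    finally show ?thesis using f(2)[of y] by simp
  qed
  have "esssup lebesgue (\<lambda>y. ennreal \<bar>norm y powr a * f y\<bar>) \<le> ennreal B"
    by (rule esssup_I) (use B1 in \<open>auto intro!: ennreal_leI\<close>)
  then show ?thesis using True I by (simp add: weighted_Lp_norm_def Lp_norm_def)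
next
  case False
  define P where "P = enn2real p"
  have P: "enn2real (1 / p) = 1 / P" "1 \<le> P"
    using enn2real_one_divide[OF False p] by (simp_all add: P_def)
  have pt: "\<bar>norm y powr a * f y\<bar> powr P \<le> B powr P * g y" for y
  proof -
    have "\<bar>norm y powr a * f y\<bar> powr P \<le> (B * g y powr (1 / P)) powr P"
      by (rule powr_mono2) (use P le[of y] f(2)[of y] in auto)
    also have "\<dots> = B powr P * g y"
      using P B g(2)[of y] by (cases "g y = 0") (simp_all add: powr_mult powr_powr)
    finally show ?thesis .
  qed
  define J where "J = (\<integral>\<^sup>+y. ennreal (\<bar>norm y powr a * f y\<bar> powr P) \<partial>lebesgue)"
  have "J \<le> (\<integral>\<^sup>+y. ennreal (B powr P) * ennreal (g y) \<partial>lebesgue)"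
    unfolding J_def by (rule nn_integral_mono) (use pt g in \<open>auto simp: ennreal_mult[symmetric] intro!: ennreal_leI\<close>)
  also have "\<dots> = ennreal (B powr P) * (\<integral>\<^sup>+y. ennreal (g y) \<partial>lebesgue)"
    by (rule nn_integral_cmult) (use g in measurable)
  also have "\<dots> \<le> ennreal (B powr P) * ennreal I"
    by (rule mult_left_mono) (use I in auto)
  also have "\<dots> = ennreal (B powr P * I)" using I by (simp add: ennreal_mult)
  finally have J: "J \<le> ennreal (B powr P * I)" .
  then have Jf: "J \<noteq> \<infinity>" by (auto simp: top_unique)
  have "enn2real J \<le> B powr P * I"
    using J I by (metis enn2real_leI mult_nonneg_nonneg powr_ge_zero less_imp_le)
  then have "enn2real J powr (1 / P) \<le> (B powr P * I) powr (1 / P)"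
    by (rule powr_mono2[rotated 2]) (use P in auto)
  also have "\<dots> = B * I powr (1 / P)"
    using P B I by (cases "B = 0") (simp_all add: powr_mult powr_powr)
  finally show ?thesis
    using False Jf P
    by (auto simp: weighted_Lp_norm_def Lp_norm_def Let_def J_def P_def intro!: ennreal_leI)
qed

section \<open>Growth exponents, generic vectors and orthogonal grids\<close>

text \<open>Otherwise \<open>n powr (\<alpha> - \<beta>)\<close> would tend to infinity while
  staying below \<open>K / c\<close>. Each condition on the exponents is read off from a family of
  test functions in this way.\<close>

lemma powr_le_imp_exponent_le:
  fixes \<alpha> \<beta> c K :: real
  assumes "0 < c" and le: "\<And>n::nat. n \<ge> n0 \<Longrightarrow> c * real n powr \<alpha> \<le> K * real n powr \<beta>"
  shows "\<alpha> \<le> \<beta>"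
proof (rule ccontr)
  assume "\<not> \<alpha> \<le> \<beta>"
  then have "filterlim (\<lambda>n. real n powr (\<alpha> - \<beta>)) at_top sequentially"
    by real_asymp
  then have "\<forall>\<^sub>F n in sequentially. K / c + 1 \<le> real n powr (\<alpha> - \<beta>)"
    by (simp add: filterlim_at_top)
  moreover have "\<forall>\<^sub>F n in sequentially. n \<ge> max 1 n0" by (rule eventually_ge_at_top)
  ultimately have "\<forall>\<^sub>F n::nat in sequentially. False"
  proof eventually_elim
    case (elim n)
    have n: "0 < real n powr \<beta>" using elim by simp
    have "c * (real n powr (\<alpha> - \<beta>) * real n powr \<beta>) \<le> K * real n powr \<beta>"
      using le[of n] elim by (simp add: powr_add[symmetric])
    then have "c * real n powr (\<alpha> - \<beta>) \<le> K" using n by simp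
    moreover have "c * (K / c + 1) \<le> c * real n powr (\<alpha> - \<beta>)"
      using elim(1) assms(1) by (intro mult_left_mono) auto
    moreover have "c * (K / c + 1) = K + c" using assms(1) by (simp add: distrib_left)
    ultimately show False using assms(1) by linarith
  qed
  then show False by simp
qed

text \<open>Finitely many hyperplanes are null sets, so they do not cover the space.\<close>

lemma ex_inner_nonzero:
  fixes F :: "'a::euclidean_space set"
  assumes "finite F" "0 \<notin> F"
  obtains w where "\<And>u. u \<in> F \<Longrightarrow> u \<bullet> w \<noteq> 0"
proof -
  have "negligible (\<Union>u\<in>F. {w. u \<bullet> w = 0})"
    using assms by (intro negligible_Union) (auto intro!: negligible_hyperplane)
  then have "(\<Union>u\<in>F. {w. u \<bullet> w = 0}) \<noteq> UNIV" by auto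
  then show ?thesis using that by blast
qed

text \<open>Let \<open>q\<close> be the projection onto the orthogonal complement of
  \<open>V\<close>. It does not vanish on vectors outside \<open>V\<close>, so some \<open>w\<close>
  is generic for their projections. By symmetry of the projection,
  \<open>u \<bullet> q w = q u \<bullet> w\<close>, and \<open>q w\<close> is the required
  vector.\<close>

lemma ex_inner_nonzero_orthogonal:
  fixes F V :: "'a::euclidean_space set"
  assumes "finite F" "subspace V"
  obtains w where "\<And>u. u \<in> V \<Longrightarrow> u \<bullet> w = 0" "\<And>u. u \<in> F \<Longrightarrow> u \<notin> V \<Longrightarrow> u \<bullet> w \<noteq> 0"
proof -
  have "\<exists>z. (\<forall>x\<in>V. z \<bullet> x = 0) \<and> u - z \<in> V" for u
    using orthogonal_subspace_decomp_exists[of V u] span_eq_iff[of V] assms(2)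
    by (metis add_diff_cancel_right' orthogonal_def)
  then obtain q where q: "\<And>u x. x \<in> V \<Longrightarrow> q u \<bullet> x = 0" "\<And>u. u - q u \<in> V"
    by metis
  have "0 \<notin> q ` (F - V)" using q(2) by (metis Diff_iff diff_zero imageE)
  then obtain w where w: "\<And>u. u \<in> q ` (F - V) \<Longrightarrow> u \<bullet> w \<noteq> 0"
    using ex_inner_nonzero[of "q ` (F - V)"] assms(1) by auto
  show ?thesis
  proof (rule that[of "q w"])
    show "u \<bullet> q w = 0" if "u \<in> V" for u using q(1)[OF that] by (simp add: inner_commute)
    show "u \<bullet> q w \<noteq> 0" if "u \<in> F" "u \<notin> V" for u
    proof -
      have "u \<bullet> q w = q u \<bullet> q w"
        using q(1)[OF q(2)[of u], of w] by (simp add: inner_diff_right inner_commute)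
      also have "\<dots> = q u \<bullet> w"
        using q(1)[OF q(2)[of w], of u] by (simp add: inner_diff_right)
      finally show ?thesis using w that by auto
    qed
  qed
qed

text \<open>After division by \<open>r\<close> the base lies between \<open>a\<close> and
  \<open>b\<close>. The sign of \<open>t\<close> decides which end gives the larger power, hence the
  maximum and minimum.\<close>

lemma powr_between:
  fixes a b r t y :: real
  assumes "0 < a" "0 < r" "a * r \<le> y" "y \<le> b * r"
  shows "y powr t \<le> max (a powr t) (b powr t) * r powr t"
    and "min (a powr t) (b powr t) * r powr t \<le> y powr t"
proof -
  define z where "z = y / r"
  have z: "y = z * r" "a \<le> z" "z \<le> b" using assms by (auto simp: z_def field_simps)
  have y: "y powr t = z powr t * r powr t" using z assms by (simp add: powr_mult)
  have "min (a powr t) (b powr t) \<le> z powr t \<and> z powr t \<le> max (a powr t) (b powr t)"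
  proof (cases "0 \<le> t")
    case True
    then have "a powr t \<le> z powr t" "z powr t \<le> b powr t"
      using z assms by (auto intro!: powr_mono2)
    then show ?thesis by simp
  next
    case False
    then have "z powr t \<le> a powr t" "b powr t \<le> z powr t"
      using z assms by (auto intro!: powr_mono2')
    then show ?thesis by simp
  qed
  then show "y powr t \<le> max (a powr t) (b powr t) * r powr t"
    "min (a powr t) (b powr t) * r powr t \<le> y powr t"
    unfolding y by (auto intro!: mult_right_mono)
qed

text \<open>Packing balls around the points of \<open>Q n\<close> gives the volume growth needed for (iv) without computing the
  Jacobian of a dilation orthogonal to \<open>V\<close>.\<close>

lemma ex_separated_orthogonal:
  fixes V :: "(real ^ 'm::finite) set"
  assumes V: "subspace V"
  obtains A :: real and Q :: "nat \<Rightarrow> ((real ^ 'k::finite) ^ 'm) set"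
  where "0 < A" "\<And>n. finite (Q n)" "\<And>n. card (Q n) = n ^ ((CARD('m) - dim V) * CARD('k))"
    "\<And>n q u. q \<in> Q n \<Longrightarrow> u \<in> V \<Longrightarrow> vec_dot u q = 0"
    "\<And>n q. q \<in> Q n \<Longrightarrow> norm q \<le> A * n"
    "\<And>n q q'. q \<in> Q n \<Longrightarrow> q' \<in> Q n \<Longrightarrow> q \<noteq> q' \<Longrightarrow> 1 \<le> dist q q'"
proof -
  define W where "W = {y \<in> UNIV. \<forall>x\<in>V. orthogonal x y}"
  have "subspace W" unfolding W_def by (auto simp: subspace_def orthogonal_clauses)
  then obtain B where B: "B \<subseteq> W" "pairwise orthogonal B" "\<And>b. b \<in> B \<Longrightarrow> norm b = 1" "independent B"
    "card B = dim W"
    using orthonormal_basis_subspace[of W] by metis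
  have finB: "finite B" using B(4) by (rule independent_imp_finite)
  have "dim W + dim V = CARD('m)"
    using dim_subspace_orthogonal_to_vectors[OF V subspace_UNIV] by (simp add: W_def)
  then have cardB: "card B = CARD('m) - dim V" using B(5) by simp
  \<comment> \<open>The grid is indexed by integer coordinates in \<open>{..<n}\<close>, one for
    each pair of an orthonormal basis vector of the complement of \<open>V\<close> and a coordinate
    of \<open>real ^ 'k\<close>.\<close>
  define Z where "Z n = (PiE (B \<times> (UNIV :: 'k set)) (\<lambda>_. {..<n}))" for n :: nat
  define z :: "((real ^ 'm) \<times> 'k \<Rightarrow> nat) \<Rightarrow> real ^ 'm \<Rightarrow> real ^ 'k"
    where "z f b = (\<chi> l. real (f (b, l)))" for f b
  define q :: "((real ^ 'm) \<times> 'k \<Rightarrow> nat) \<Rightarrow> (real ^ 'k) ^ 'm"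
    where "q f = (\<Sum>b\<in>B. (\<chi> i. (b $ i) *\<^sub>R z f b))" for f
  have dot_q: "vec_dot u (q f) = (\<Sum>b\<in>B. (u \<bullet> b) *\<^sub>R z f b)" for u f
    by (simp add: q_def linear_sum[OF linear_vec_dot] vec_dot_tensor)
  \<comment> \<open>Orthonormality makes pairing with \<open>b\<close> read off the
    \<open>b\<close>-coordinates of the grid point.\<close>
  have dot_b: "vec_dot b (q f) = z f b" if "b \<in> B" for b f
  proof -
    have "(b \<bullet> c) *\<^sub>R z f c = (if c = b then z f c else 0)" if "c \<in> B" for c
      using B(2,3) that \<open>b \<in> B\<close> by (auto simp: pairwise_def orthogonal_def norm_eq_1)
    then have "vec_dot b (q f) = (\<Sum>c\<in>B. if c = b then z f c else 0)"
      unfolding dot_q by (intro sum.cong) auto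
    then show ?thesis using that finB by simp
  qed
  \<comment> \<open>Distinct index functions differ by at least 1 in some integer coordinate, and
    reading off a coordinate does not increase norms because \<open>norm b = 1\<close>.\<close>
  have sep: "1 \<le> norm (q f - q g)" if fg: "f \<in> Z n" "g \<in> Z n" "f \<noteq> g" for f g n
  proof -
    obtain b l where b: "b \<in> B" "f (b, l) \<noteq> g (b, l)"
      using fg PiE_ext[of f "B \<times> UNIV" "\<lambda>_. {..<n}" g] unfolding Z_def by auto
    have "1 \<le> \<bar>real (f (b, l)) - real (g (b, l))\<bar>" using b(2) by linarith
    also have "\<dots> = \<bar>(z f b - z g b) $ l\<bar>" by (simp add: z_def)
    also have "\<dots> \<le> norm (z f b - z g b)" by (rule component_le_norm_cart)
    also have "z f b - z g b = vec_dot b (q f - q g)"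
      using dot_b[OF b(1)] by (simp add: linear_diff[OF linear_vec_dot])
    also have "norm \<dots> \<le> norm b * norm (q f - q g)" by (rule norm_vec_dot_le)
    finally show ?thesis using B(3)[OF b(1)] by simp
  qed
  have inj: "inj_on q (Z n)" for n
    using sep[of _ n] by (intro inj_onI) (metis diff_self norm_zero not_one_le_zero)
  \<comment> \<open>The summand 1 keeps \<open>A\<close> positive when \<open>V\<close> is the whole
    space and \<open>B\<close> is empty.\<close>
  define A where "A = real (card B * (CARD('m) * CARD('k))) + 1"
  have bound: "norm (q f) \<le> A * n" if f: "f \<in> Z n" for f n
  proof -
    have z: "norm (z f b) \<le> CARD('k) * real n" if "b \<in> B" for b
    proof -
      have "norm (z f b) \<le> (\<Sum>l\<in>UNIV. \<bar>z f b $ l\<bar>)" by (rule norm_le_l1_cart)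
      also have "\<dots> \<le> (\<Sum>l\<in>(UNIV::'k set). real n)"
        using f that by (intro sum_mono) (auto simp: z_def Z_def PiE_iff less_imp_le)
      finally show ?thesis by simp
    qed
    have "norm (\<chi> i. (b $ i) *\<^sub>R z f b) \<le> CARD('m) * (CARD('k) * real n)" if b: "b \<in> B" for b
    proof -
      have "norm (\<chi> i. (b $ i) *\<^sub>R z f b) \<le> (\<Sum>i\<in>UNIV. norm ((b $ i) *\<^sub>R z f b))"
        unfolding norm_vec_def by (rule order_trans[OF L2_set_le_sum]) auto
      also have "\<dots> \<le> (\<Sum>i\<in>(UNIV::'m set). 1 * (CARD('k) * real n))"
        using component_le_norm_cart[of b] B(3)[OF b] z[OF b]
        unfolding norm_scaleR by (intro sum_mono mult_mono) auto
      finally show ?thesis by simp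
    qed
    then have "norm (q f) \<le> (\<Sum>b\<in>B. CARD('m) * (CARD('k) * real n))"
      unfolding q_def by (rule sum_norm_le)
    also have "\<dots> \<le> A * n" by (simp add: A_def algebra_simps)
    finally show ?thesis .
  qed
  show thesis
  proof (rule that[of A "\<lambda>n. q ` Z n"])
    show "0 < A" unfolding A_def by (simp add: add_nonneg_pos)
    show "finite (q ` Z n)" for n unfolding Z_def using finB by (intro finite_imageI finite_PiE) auto
    show "card (q ` Z n) = n ^ ((CARD('m) - dim V) * CARD('k))" for n
    proof -
      have "card (q ` Z n) = card (Z n)" by (rule card_image[OF inj])
      also have "\<dots> = n ^ card (B \<times> (UNIV :: 'k set))"
        unfolding Z_def using finB by (subst card_PiE) auto
      finally show ?thesis by (simp add: card_cartesian_product cardB)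
    qed
    show "vec_dot u y = 0" if "y \<in> q ` Z n" "u \<in> V" for n y u
    proof -
      have "u \<bullet> b = 0" if "b \<in> B" for b
        using that B(1) \<open>u \<in> V\<close> by (auto simp: W_def orthogonal_def)
      then show ?thesis using that(1) by (auto simp: dot_q)
    qed
    show "norm y \<le> A * real n" if "y \<in> q ` Z n" for n y using that bound by blast
    show "1 \<le> dist y y'" if "y \<in> q ` Z n" "y' \<in> q ` Z n" "y \<noteq> y'" for n y y'
      using that sep[of _ n] unfolding dist_norm by blast
  qed
qed

lemma prod_if_powr:
  fixes x :: real
  assumes "finite A" "0 < x"
  shows "(\<Prod>j\<in>A. (if P j then 1 else x) powr t j) = x powr (\<Sum>j | j \<in> A \<and> \<not> P j. t j)"
proof -
  have "(\<Prod>j\<in>A. (if P j then 1 else x) powr t j) = (\<Prod>j\<in>A. x powr (if \<not> P j then t j else 0))"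
    using assms by (intro prod.cong) auto
  also have "\<dots> = x powr (\<Sum>j\<in>A. if \<not> P j then t j else 0)"
    using assms by (simp add: powr_sum)
  also have "(\<Sum>j\<in>A. if \<not> P j then t j else 0) = (\<Sum>j | j \<in> A \<and> \<not> P j. t j)"
    using assms by (simp add: sum.inter_filter)
  finally show ?thesis .
qed

section \<open>The boundedness hypothesis and its test on annuli\<close>

text \<open>The parameter \<open>k_type\<close> only fixes the type \<open>'k\<close>, which occurs in no other parameter.\<close>

locale bounded_form =
  fixes N :: nat
    and v :: "nat \<Rightarrow> real ^ 'm::finite"
    and p :: "nat \<Rightarrow> ennreal"
    and lam :: "nat \<Rightarrow> real"
    and C :: real
    and k_type :: "'k::finite itself"
  assumes nonzero: "j \<in> {1..N} \<Longrightarrow> v j \<noteq> 0"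
    and exponents: "j \<in> {1..N} \<Longrightarrow> 1 \<le> p j"
    and C_nonneg: "0 \<le> C"
    and bound: "(\<forall>j\<in>{1..N}. f j \<in> borel_measurable lebesgue \<and> (\<forall>x. 0 \<le> f j x)) \<Longrightarrow>
      Lambda_form N v (f :: nat \<Rightarrow> real ^ 'k \<Rightarrow> real)
        \<le> ennreal C * (\<Prod>j=1..N. weighted_Lp_norm (p j) (lam j) (f j))"
begin

text \<open>Combines the norm bounds of all factors, so that a test needs only a pointwise majorant
  and one integral bound for each \<open>j\<close>.\<close>

lemma Lambda_form_le:
  fixes f g :: "nat \<Rightarrow> real ^ 'k \<Rightarrow> real"
  assumes "\<And>j. j \<in> {1..N} \<Longrightarrow> f j \<in> borel_measurable lebesgue" "\<And>j y. j \<in> {1..N} \<Longrightarrow> 0 \<le> f j y"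
    and "\<And>j. j \<in> {1..N} \<Longrightarrow> g j \<in> borel_measurable lebesgue" "\<And>j y. j \<in> {1..N} \<Longrightarrow> 0 \<le> g j y"
    and "\<And>j. j \<in> {1..N} \<Longrightarrow> 0 \<le> B j"
    and "\<And>j y. j \<in> {1..N} \<Longrightarrow> norm y powr lam j * f j y \<le> B j * g j y powr enn2real (1 / p j)"
    and "\<And>j. j \<in> {1..N} \<Longrightarrow> 0 < I j"
    and "\<And>j. j \<in> {1..N} \<Longrightarrow> (\<integral>\<^sup>+y. ennreal (g j y) \<partial>lebesgue) \<le> ennreal (I j)"
  shows "Lambda_form N v f \<le> ennreal (C * (\<Prod>j=1..N. B j * I j powr enn2real (1 / p j)))"
proof -
  have "Lambda_form N v f \<le> ennreal C * (\<Prod>j=1..N. weighted_Lp_norm (p j) (lam j) (f j))"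
    using assms by (intro bound) auto
  also have "\<dots> \<le> ennreal C * (\<Prod>j=1..N. ennreal (B j * I j powr enn2real (1 / p j)))"
    by (intro mult_left_mono prod_mono_ennreal weighted_Lp_norm_le[where g="g _"])
      (use assms exponents in auto)
  also have "\<dots> = ennreal (C * (\<Prod>j=1..N. B j * I j powr enn2real (1 / p j)))"
    using assms(5) by (subst prod_ennreal) (auto simp: ennreal_mult'[OF C_nonneg])
  finally show ?thesis .
qed

text \<open>Collects the factors that do not depend on the radii: the extreme values of the weights
  between \<open>a\<close> and \<open>b\<close>, and the volume of a ball of radius
  \<open>b\<close>.\<close>

definition annuli_const :: "real \<Rightarrow> real \<Rightarrow> real" where
  "annuli_const a b = C * (\<Prod>j=1..N. max (a powr lam j) (b powr lam j) *
    (unit_ball_vol (real (card (UNIV :: 'k set))) * b ^ card (UNIV :: 'k set)) powr enn2real (1 / p j))"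

text \<open>Test on indicators of the sets \<open>S j\<close>, an annulus of scale
  \<open>r j\<close> cut by a ball of scale \<open>s j\<close> around \<open>c j\<close>. The form
  is at least the volume of \<open>T\<close>, since all factors are 1 there. The weight contributes
  \<open>r j powr lam j\<close> and the volume of the ball contributes the power of
  \<open>s j\<close>. The scales are separate because a small ball may lie far from the
  origin.\<close>

lemma emeasure_le_of_annuli:
  fixes a b :: real and r s :: "nat \<Rightarrow> real" and c :: "nat \<Rightarrow> real ^ 'k" and T :: "((real ^ 'k) ^ 'm) set"
  assumes ab: "0 < a" "a \<le> b"
    and r: "\<And>j. 0 < r j" and s: "\<And>j. 0 < s j" and T: "T \<in> sets lebesgue"
    and *: "\<And>x j. x \<in> T \<Longrightarrow> j \<in> {1..N} \<Longrightarrow> a * r j \<le> norm (vec_dot (v j) x)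
      \<and> norm (vec_dot (v j) x) \<le> b * r j \<and> norm (vec_dot (v j) x - c j) \<le> b * s j"
  shows "emeasure lebesgue T \<le> ennreal (annuli_const a b *
    (\<Prod>j=1..N. r j powr lam j * s j powr (CARD('k) * enn2real (1 / p j))))"
proof -
  define \<omega> where "\<omega> = unit_ball_vol (real CARD('k))"
  have \<omega>: "0 < \<omega>" by (simp add: \<omega>_def)
  define L where "L j = max (a powr lam j) (b powr lam j)" for j
  define M where "M j = (\<omega> * b ^ CARD('k)) powr enn2real (1 / p j)" for j
  have b: "0 < b" using ab by simp
  define S where "S j = {y. a * r j \<le> norm y} \<inter> cball 0 (b * r j) \<inter> cball (c j) (b * s j)" for j
  define f where "f j = (indicator (S j) :: _ \<Rightarrow> real)" for j
  have S: "S j \<in> sets lebesgue" for j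
    unfolding S_def by (intro sets.Int) (auto intro!: borel_closed closed_Collect_le continuous_intros)
  have ST: "vec_dot (v j) x \<in> S j" if "x \<in> T" "j \<in> {1..N}" for x j
    using *[OF that] by (auto simp: S_def dist_norm norm_minus_commute)
  have "emeasure lebesgue T = (\<integral>\<^sup>+x. indicator T x \<partial>lebesgue)" using T by simp
  also have "\<dots> \<le> Lambda_form N v f"
    unfolding Lambda_form_def
  proof (rule nn_integral_mono)
    fix x
    show "indicator T x \<le> ennreal (\<Prod>i = 1..N. f i (vec_dot (v i) x))"
      using ST[of x] by (cases "x \<in> T") (simp_all add: f_def)
  qed
  also have "\<dots> \<le> ennreal (C * (\<Prod>j=1..N. (L j * r j powr lam j) * (\<omega> * (b * s j) ^ CARD('k)) powr enn2real (1 / p j)))"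
  proof (rule Lambda_form_le[where g=f])
    fix j y
    show "f j \<in> borel_measurable lebesgue" unfolding f_def using S by simp
    then show "f j \<in> borel_measurable lebesgue" .
    show f0: "0 \<le> f j y" by (simp add: f_def)
    then show "0 \<le> f j y" .
    show "0 \<le> L j * r j powr lam j" by (simp add: L_def le_max_iff_disj)
    show "norm y powr lam j * f j y \<le> L j * r j powr lam j * f j y powr enn2real (1 / p j)"
      using powr_between(1)[OF ab(1) r[of j], of "norm y" b "lam j"]
      by (cases "y \<in> S j") (auto simp: f_def S_def L_def)
    show "0 < \<omega> * (b * s j) ^ CARD('k)" using \<omega> b s by simp
    have "(\<integral>\<^sup>+y. ennreal (f j y) \<partial>lebesgue) = emeasure lebesgue (S j)"
      using S by (simp add: f_def ennreal_indicator)
    also have "\<dots> \<le> emeasure lebesgue (cball (c j) (b * s j))"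
      by (rule emeasure_mono) (auto simp: S_def)
    also have "\<dots> = ennreal (\<omega> * (b * s j) ^ CARD('k))"
      using b s[of j] by (subst emeasure_lebesgue_ball) (auto simp: \<omega>_def)
    finally show "(\<integral>\<^sup>+y. ennreal (f j y) \<partial>lebesgue) \<le> ennreal (\<omega> * (b * s j) ^ CARD('k))" .
  qed
  also have "(\<Prod>j=1..N. (L j * r j powr lam j) * (\<omega> * (b * s j) ^ CARD('k)) powr enn2real (1 / p j))
     = (\<Prod>j=1..N. (L j * M j) * (r j powr lam j * s j powr (CARD('k) * enn2real (1 / p j))))"
  proof (rule prod.cong[OF refl])
    fix j
    have "(\<omega> * (b * s j) ^ CARD('k)) powr enn2real (1 / p j)
      = ((\<omega> * b ^ CARD('k)) * s j powr CARD('k)) powr enn2real (1 / p j)"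
      using s[of j] by (simp add: power_mult_distrib powr_realpow mult.assoc)
    also have "\<dots> = M j * s j powr (CARD('k) * enn2real (1 / p j))"
      using \<omega> b s[of j] by (subst powr_mult) (auto simp: M_def powr_powr)
    finally show "(L j * r j powr lam j) * (\<omega> * (b * s j) ^ CARD('k)) powr enn2real (1 / p j)
      = (L j * M j) * (r j powr lam j * s j powr (CARD('k) * enn2real (1 / p j)))" by simp
  qed
  finally show ?thesis
    by (simp add: prod.distrib mult.assoc L_def M_def \<omega>_def annuli_const_def)
qed

section \<open>Balls adapted to a subspace\<close>

text \<open>\<open>P n\<close> is a point drifting away orthogonally to \<open>V\<close> at linear speed; \<open>q\<close> is a displacement that the
  vectors of \<open>V\<close> do not see.\<close>

definition adapted_balls ::
    "(real ^ 'm) set \<Rightarrow> real \<Rightarrow> real \<Rightarrow> real \<Rightarrow> nat \<Rightarrow> (nat \<Rightarrow> (real ^ 'k) ^ 'm) \<Rightarrow> bool" where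
  "adapted_balls V a b \<epsilon> n0 P \<longleftrightarrow> 0 < a \<and> a \<le> b \<and> 0 < \<epsilon> \<and> 1 \<le> n0 \<and>
    (\<forall>n\<ge>n0. \<forall>q x. \<forall>j\<in>{1..N}. (\<forall>u\<in>V. vec_dot u q = 0) \<longrightarrow> norm q \<le> \<epsilon> * real n \<longrightarrow>
      norm (x - (P n + q)) \<le> \<epsilon> \<longrightarrow>
      a * (if v j \<in> V then 1 else real n) \<le> norm (vec_dot (v j) x) \<and>
      norm (vec_dot (v j) x) \<le> b * (if v j \<in> V then 1 else real n) \<and>
      norm (vec_dot (v j) x - vec_dot (v j) (P n + q)) \<le> b)"

text \<open>Take \<open>P n\<close> to be the tensor of \<open>w + n w'\<close> with a unit vector,
  where \<open>w\<close> is generic for all \<open>v j\<close>, and \<open>w'\<close> is orthogonal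
  to \<open>V\<close> and generic for the \<open>v j\<close> outside \<open>V\<close>. Then
  \<open>v j\<close> sees a vector of bounded size if it lies in \<open>V\<close>, and of size
  comparable to \<open>n\<close> otherwise.\<close>

lemma ex_adapted_balls:
  assumes V: "subspace V"
  obtains a b \<epsilon> n0 P where "adapted_balls V a b \<epsilon> n0 P"
proof -
  have fin: "finite (v ` {1..N})" and v0: "0 \<notin> v ` {1..N}" using nonzero by force+
  obtain w where "\<And>u. u \<in> v ` {1..N} \<Longrightarrow> u \<bullet> w \<noteq> 0"
    using ex_inner_nonzero[OF fin v0] by blast
  then have w: "v j \<bullet> w \<noteq> 0" if "j \<in> {1..N}" for j using that by blast
  obtain w' where w': "\<And>u. u \<in> V \<Longrightarrow> u \<bullet> w' = 0"
    and "\<And>u. u \<in> v ` {1..N} \<Longrightarrow> u \<notin> V \<Longrightarrow> u \<bullet> w' \<noteq> 0"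
    using ex_inner_nonzero_orthogonal[OF fin V] by blast
  then have w'2: "v j \<bullet> w' \<noteq> 0" if "j \<in> {1..N}" "v j \<notin> V" for j using that by blast
  \<comment> \<open>A common lower bound for the nonzero inner products; inserting 1 keeps the set
    nonempty.\<close>
  define \<delta> where "\<delta> = Min (insert 1 ((\<lambda>j. \<bar>v j \<bullet> w\<bar>) ` {1..N} \<union> (\<lambda>j. \<bar>v j \<bullet> w'\<bar>) ` {j\<in>{1..N}. v j \<notin> V}))"
  have \<delta>: "0 < \<delta>" unfolding \<delta>_def by (subst Min_gr_iff) (use w w'2 in auto)
  have \<delta>w: "\<delta> \<le> \<bar>v j \<bullet> w\<bar>" if "j \<in> {1..N}" for j
    unfolding \<delta>_def using that by (intro Min_le) auto
  have \<delta>w': "\<delta> \<le> \<bar>v j \<bullet> w'\<bar>" if "j \<in> {1..N}" "v j \<notin> V" for j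
    unfolding \<delta>_def using that by (intro Min_le) auto
  define A where "A = 1 + (\<Sum>j=1..N. norm (v j) + \<bar>v j \<bullet> w\<bar> + \<bar>v j \<bullet> w'\<bar>)"
  have A: "norm (v j) + \<bar>v j \<bullet> w\<bar> + \<bar>v j \<bullet> w'\<bar> \<le> A" if "j \<in> {1..N}" for j
    unfolding A_def using member_le_sum[of j "{1..N}" "\<lambda>j. norm (v j) + \<bar>v j \<bullet> w\<bar> + \<bar>v j \<bullet> w'\<bar>"] that
    by auto
  have A1: "1 \<le> A" unfolding A_def by (simp add: sum_nonneg)
  \<comment> \<open>Chosen so that the error from \<open>x\<close> is at most
    \<open>\<delta> / 8\<close> and the error from the displacement \<open>q\<close> at most
    \<open>n * \<delta> / 8\<close>.\<close>
  define \<epsilon> where "\<epsilon> = \<delta> / (8 * A)"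
  have \<epsilon>: "0 < \<epsilon>" using \<delta> A1 by (simp add: \<epsilon>_def)
  have A\<epsilon>: "A * \<epsilon> = \<delta> / 8" using A1 by (simp add: \<epsilon>_def)
  \<comment> \<open>From \<open>n0\<close> on, \<open>A \<le> n * \<delta> / 4\<close>, so the drift
    along \<open>w'\<close> dominates the fixed part along \<open>w\<close>. The lower bound
    \<open>n * \<delta> / 2\<close> remains after subtracting both errors.\<close>
  define n0 where "n0 = nat \<lceil>4 * A / \<delta>\<rceil> + 1"
  define e :: "real ^ 'k" where "e = axis undefined 1"
  have e: "norm e = 1" by (simp add: e_def norm_axis_1)
  define P where "P n = (\<chi> i. ((w + real n *\<^sub>R w') $ i) *\<^sub>R e)" for n :: nat
  show thesis
  proof (rule that[of "\<delta> / 2" "2 * A + \<delta>" \<epsilon> n0 P], unfold adapted_balls_def, intro conjI allI ballI impI)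
    show "0 < \<delta> / 2" "\<delta> / 2 \<le> 2 * A + \<delta>" "0 < \<epsilon>" "1 \<le> n0" using \<delta> \<epsilon> A1 by (auto simp: n0_def)
    fix n :: nat and q x :: "(real ^ 'k) ^ 'm" and j
    assume n: "n0 \<le> n" and q: "\<forall>u\<in>V. vec_dot u q = 0" "norm q \<le> \<epsilon> * n"
      and x: "norm (x - (P n + q)) \<le> \<epsilon>" and j: "j \<in> {1..N}"
    have "4 * A / \<delta> \<le> real n" using n by (simp add: n0_def) linarith
    then have nA: "A \<le> real n * \<delta> / 4" using \<delta> by (simp add: field_simps)
    have n1: "1 \<le> real n" using n by (simp add: n0_def)
    define t where "t = v j \<bullet> w + real n * (v j \<bullet> w')"
    have dotP: "vec_dot (v j) (P n) = t *\<^sub>R e"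
      unfolding P_def vec_dot_tensor t_def by (simp add: inner_add_right)
    have split: "vec_dot (v j) x = t *\<^sub>R e + vec_dot (v j) q + vec_dot (v j) (x - (P n + q))"
      by (simp add: linear_add[OF linear_vec_dot] linear_diff[OF linear_vec_dot] dotP)
    have err: "norm (vec_dot (v j) (x - (P n + q))) \<le> \<delta> / 8"
    proof -
      have "norm (vec_dot (v j) (x - (P n + q))) \<le> norm (v j) * norm (x - (P n + q))" by (rule norm_vec_dot_le)
      also have "\<dots> \<le> A * \<epsilon>" using A[OF j] x A1 by (intro mult_mono) auto
      finally show ?thesis by (simp add: A\<epsilon>)
    qed
    have "norm (vec_dot (v j) q) \<le> norm (v j) * norm q" by (rule norm_vec_dot_le)
    also have "\<dots> \<le> A * (\<epsilon> * n)" using A[OF j] q A1 by (intro mult_mono) auto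
    also have "\<dots> = real n * \<delta> / 8" using A\<epsilon> by (simp add: mult.assoc[symmetric])
    finally have errq: "norm (vec_dot (v j) q) \<le> real n * \<delta> / 8" .
    have n\<delta>: "\<delta> \<le> real n * \<delta>" "A \<le> real n * A" using n1 \<delta> A1 by auto
    have up: "norm (vec_dot (v j) x) \<le> \<bar>t\<bar> + norm (vec_dot (v j) q) + \<delta> / 8"
      unfolding split using e err norm_triangle_ineq[of "t *\<^sub>R e + vec_dot (v j) q" "vec_dot (v j) (x - (P n + q))"]
        norm_triangle_ineq[of "t *\<^sub>R e" "vec_dot (v j) q"] by simp
    have lo: "\<bar>t\<bar> - norm (vec_dot (v j) q) - \<delta> / 8 \<le> norm (vec_dot (v j) x)"
      unfolding split using e err norm_diff_ineq[of "t *\<^sub>R e + vec_dot (v j) q" "vec_dot (v j) (x - (P n + q))"]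
        norm_diff_ineq[of "t *\<^sub>R e" "vec_dot (v j) q"] by simp
    have "norm (vec_dot (v j) x - vec_dot (v j) (P n + q)) \<le> 2 * A + \<delta>"
      using err A1 \<delta> by (simp add: linear_diff[OF linear_vec_dot])
    moreover have "\<delta> / 2 * (if v j \<in> V then 1 else real n) \<le> norm (vec_dot (v j) x) \<and>
      norm (vec_dot (v j) x) \<le> (2 * A + \<delta>) * (if v j \<in> V then 1 else real n)"
    proof (cases "v j \<in> V")
      case True
      then have t: "t = v j \<bullet> w" "norm (vec_dot (v j) q) = 0" using w' q by (simp_all add: t_def)
      have "\<delta> / 2 \<le> norm (vec_dot (v j) x)" "norm (vec_dot (v j) x) \<le> 2 * A + \<delta>"
        using up lo \<delta>w[OF j] A[OF j] A1 \<delta> norm_ge_zero[of "v j"] abs_ge_zero[of "v j \<bullet> w'"]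
        unfolding t by linarith+
      then show ?thesis using True by simp
    next
      case False
      have wA: "\<bar>v j \<bullet> w\<bar> \<le> A"
        using A[OF j] norm_ge_zero[of "v j"] abs_ge_zero[of "v j \<bullet> w'"] by linarith
      have "\<bar>v j \<bullet> w'\<bar> \<le> A"
        using A[OF j] norm_ge_zero[of "v j"] abs_ge_zero[of "v j \<bullet> w"] by linarith
      then have "real n * \<delta> \<le> real n * \<bar>v j \<bullet> w'\<bar>" "real n * \<bar>v j \<bullet> w'\<bar> \<le> real n * A"
        using \<delta>w'[OF j False] by (auto intro!: mult_left_mono)
      then have "real n * \<delta> - A \<le> \<bar>t\<bar>" "\<bar>t\<bar> \<le> real n * A + A"
        using wA norm_triangle_ineq[of "v j \<bullet> w" "real n * (v j \<bullet> w')"]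
          norm_diff_ineq[of "real n * (v j \<bullet> w')" "v j \<bullet> w"]
        by (auto simp: t_def abs_mult add.commute)
      then have "real n * \<delta> / 2 \<le> norm (vec_dot (v j) x)"
        "norm (vec_dot (v j) x) \<le> 2 * (real n * A) + real n * \<delta>"
        using up lo errq n\<delta> nA by linarith+
      then show ?thesis using False by (simp add: algebra_simps)
    qed
    ultimately show "\<delta> / 2 * (if v j \<in> V then 1 else real n) \<le> norm (vec_dot (v j) x)"
      "norm (vec_dot (v j) x) \<le> (2 * A + \<delta>) * (if v j \<in> V then 1 else real n)"
      "norm (vec_dot (v j) x - vec_dot (v j) (P n + q)) \<le> 2 * A + \<delta>" by blast+
  qed
qed

section \<open>Conditions (iii) and (iv): translations and dilations away from a subspace\<close>

lemma sum_scaled_exponents: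
  "(\<Sum>j\<in>J. lam j + CARD('k) * enn2real (1 / p j))
    = (\<Sum>j\<in>J. enn2real (1 / p j) + lam j / real CARD('k)) * CARD('k)"
  unfolding sum_distrib_right by (intro sum.cong) (simp_all add: field_simps)

text \<open>A ball of fixed radius around \<open>P n\<close> has constant volume. Its images lie in
  balls of bounded size, so the right-hand side depends on \<open>n\<close> only through the weights
  at distance \<open>n\<close>, for \<open>v j\<close> outside \<open>V\<close>.\<close>

lemma sum_lam_nonneg:
  assumes V: "subspace V"
  shows "0 \<le> (\<Sum>j | j \<in> {1..N} \<and> v j \<notin> V. lam j)"
proof -
  obtain a b \<epsilon> n0 P where adapted: "adapted_balls V a b \<epsilon> n0 P"
    by (rule ex_adapted_balls[OF V])
  then have ab: "0 < a" "a \<le> b" and \<epsilon>: "0 < \<epsilon>" and n0: "1 \<le> n0"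
    by (simp_all add: adapted_balls_def)
  note est = adapted[unfolded adapted_balls_def, THEN conjunct2, THEN conjunct2, THEN conjunct2, THEN conjunct2,
      rule_format]
  note K = emeasure_le_of_annuli[OF ab]
  define c0 where "c0 = unit_ball_vol (real DIM((real ^ 'k) ^ 'm)) * \<epsilon> ^ DIM((real ^ 'k) ^ 'm)"
  have c0: "0 < c0" using \<epsilon> unfolding c0_def by simp
  show ?thesis
  proof (rule powr_le_imp_exponent_le[OF c0, of n0])
    fix n assume n: "n0 \<le> n"
    then have n1: "0 < real n" using n0 by simp
    have "ennreal c0 = emeasure lebesgue (ball (P n) \<epsilon>)"
      using \<epsilon> by (subst emeasure_lebesgue_ball) (auto simp: c0_def)
    also have "\<dots> \<le> ennreal (annuli_const a b * (\<Prod>j=1..N. (if v j \<in> V then 1 else real n) powr lam j *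
        1 powr (CARD('k) * enn2real (1 / p j))))"
    \<comment> \<open>The annuli have scale 1 or \<open>n\<close>, but the balls around the images
      of \<open>P n\<close> all have scale 1; the displacement is zero.\<close>
    proof (rule K[where c = "\<lambda>j. vec_dot (v j) (P n)"])
      fix x j assume x: "x \<in> ball (P n) \<epsilon>" and j: "j \<in> {1..N}"
      show "a * (if v j \<in> V then 1 else real n) \<le> norm (vec_dot (v j) x) \<and>
         norm (vec_dot (v j) x) \<le> b * (if v j \<in> V then 1 else real n) \<and>
         norm (vec_dot (v j) x - vec_dot (v j) (P n)) \<le> b * 1"
        using est[OF n j linear_0[OF linear_vec_dot], of x] x \<epsilon>
        by (simp add: dist_norm norm_minus_commute)
    qed (use n1 in auto)
    also have "(\<Prod>j=1..N. (if v j \<in> V then 1 else real n) powr lam j *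
        1 powr (CARD('k) * enn2real (1 / p j))) = real n powr (\<Sum>j | j \<in> {1..N} \<and> v j \<notin> V. lam j)"
      using prod_if_powr[of "{1..N}" "real n" "\<lambda>j. v j \<in> V" lam] n1 by simp
    finally show "c0 * real n powr 0 \<le> annuli_const a b * real n powr (\<Sum>j | j \<in> {1..N} \<and> v j \<notin> V. lam j)"
      using c0 n1 by (simp add: ennreal_le_iff2)
  qed
qed

text \<open>Around \<open>P n\<close> there is room for
  \<open>n ^ ((CARD('m) - dim V) * CARD('k))\<close> disjoint balls of fixed radius, displaced
  orthogonally to \<open>V\<close>. All their images stay in annuli of scale 1 for
  \<open>v j\<close> in \<open>V\<close> and \<open>n\<close> otherwise.\<close>

lemma sum_exponents_ge:
  assumes V: "subspace V"
  shows "real CARD('m) - real (dim V) \<le> (\<Sum>j | j \<in> {1..N} \<and> v j \<notin> V. enn2real (1 / p j) + lam j / real CARD('k))"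
proof -
  obtain a b \<epsilon> n0 P where adapted: "adapted_balls V a b \<epsilon> n0 P"
    by (rule ex_adapted_balls[OF V])
  then have ab: "0 < a" "a \<le> b" and \<epsilon>: "0 < \<epsilon>" and n0: "1 \<le> n0"
    by (simp_all add: adapted_balls_def)
  note est = adapted[unfolded adapted_balls_def, THEN conjunct2, THEN conjunct2, THEN conjunct2, THEN conjunct2,
      rule_format]
  note K = emeasure_le_of_annuli[OF ab]
  obtain A :: real and Q :: "nat \<Rightarrow> ((real ^ 'k) ^ 'm) set"
  where A: "0 < A" and Q: "\<And>n. finite (Q n)" "\<And>n. card (Q n) = n ^ ((CARD('m) - dim V) * CARD('k))"
    "\<And>n q u. q \<in> Q n \<Longrightarrow> u \<in> V \<Longrightarrow> vec_dot u q = 0"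
    "\<And>n q. q \<in> Q n \<Longrightarrow> norm q \<le> A * n"
    "\<And>n q q'. q \<in> Q n \<Longrightarrow> q' \<in> Q n \<Longrightarrow> q \<noteq> q' \<Longrightarrow> 1 \<le> dist q q'"
    using ex_separated_orthogonal[OF V, where 'k = 'k] by metis
  \<comment> \<open>The bound \<open>\<epsilon> / A\<close> makes the displacements
    \<open>\<rho> *\<^sub>R q\<close> at most \<open>\<epsilon> * n\<close> long; the bound
    \<open>\<epsilon>\<close> keeps the balls of radius \<open>\<rho> / 2\<close> within the
    admissible error. The centres are at least \<open>\<rho>\<close> apart, hence
    disjointness.\<close>
  define \<rho> where "\<rho> = min \<epsilon> (\<epsilon> / A)"
  have \<rho>: "0 < \<rho>" "\<rho> \<le> \<epsilon>" "\<rho> * A \<le> \<epsilon>" using A \<epsilon> by (auto simp: \<rho>_def min_def field_simps)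
  define c0 where "c0 = unit_ball_vol (real DIM((real ^ 'k) ^ 'm)) * (\<rho> / 2) ^ DIM((real ^ 'k) ^ 'm)"
  have c0: "0 < c0" using \<rho> unfolding c0_def by simp
  define t where "t j = lam j + CARD('k) * enn2real (1 / p j)" for j
  have "real ((CARD('m) - dim V) * CARD('k)) \<le> (\<Sum>j | j \<in> {1..N} \<and> v j \<notin> V. t j)"
  proof (rule powr_le_imp_exponent_le[OF c0, of n0])
    fix n assume n: "n0 \<le> n"
    then have n1: "0 < real n" using n0 by simp
    define T where "T q = ball (P n + \<rho> *\<^sub>R q) (\<rho> / 2)" for q
    have T: "T q \<in> sets lebesgue" for q by (simp add: T_def)
    have disj: "disjoint_family_on T (Q n)"
    unfolding disjoint_family_on_def
    proof (intro ballI impI)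
      fix q q' assume q: "q \<in> Q n" "q' \<in> Q n" "q \<noteq> q'"
      have "dist (P n + \<rho> *\<^sub>R q) (P n + \<rho> *\<^sub>R q') = \<rho> * dist q q'"
        using \<rho> by (simp add: dist_norm flip: scaleR_diff_right)
      then have "\<rho> \<le> dist (P n + \<rho> *\<^sub>R q) (P n + \<rho> *\<^sub>R q')"
        using Q(5)[OF q] \<rho> by simp
      then show "T q \<inter> T q' = {}" unfolding T_def by (intro disjoint_ballI) simp
    qed
    have pw: "real n powr real ((CARD('m) - dim V) * CARD('k)) = real n ^ ((CARD('m) - dim V) * CARD('k))"
      using n1 by (rule powr_realpow)
    have "ennreal (c0 * real n powr real ((CARD('m) - dim V) * CARD('k))) = (\<Sum>q\<in>Q n. ennreal c0)"
      unfolding pw using c0 n1 by (simp add: Q(2) ennreal_mult ennreal_of_nat_eq_real_of_nat mult.commute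
          ennreal_power)
    also have "\<dots> = (\<Sum>q\<in>Q n. emeasure lebesgue (T q))"
      unfolding T_def using \<rho> by (subst emeasure_lebesgue_ball) (auto simp: c0_def)
    also have "\<dots> = emeasure lebesgue (\<Union>q\<in>Q n. T q)"
      using T disj Q(1) by (intro sum_emeasure) auto
    also have "\<dots> \<le> ennreal (annuli_const a b * (\<Prod>j=1..N. (if v j \<in> V then 1 else real n) powr lam j *
        (if v j \<in> V then 1 else real n) powr (CARD('k) * enn2real (1 / p j))))"
    \<comment> \<open>With centre 0 and equal scales, the ball constraint repeats the outer bound of
      the annulus.\<close>
    proof (rule K[where c = "\<lambda>_. 0"])
      show "(\<Union>q\<in>Q n. T q) \<in> sets lebesgue" using T Q(1) by auto
      fix x j assume x: "x \<in> (\<Union>q\<in>Q n. T q)" and j: "j \<in> {1..N}"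
      then obtain q where q: "q \<in> Q n" "x \<in> T q" by blast
      have "norm (\<rho> *\<^sub>R q) \<le> \<rho> * (A * n)" using Q(4)[OF q(1)] \<rho> by simp
      also have "\<dots> \<le> \<epsilon> * n" using \<rho>(3) by (simp add: mult_right_mono flip: mult.assoc)
      finally have "norm (\<rho> *\<^sub>R q) \<le> \<epsilon> * n" .
      moreover have "norm (x - (P n + \<rho> *\<^sub>R q)) \<le> \<epsilon>"
        using q(2) \<rho> by (simp add: T_def dist_norm norm_minus_commute)
      ultimately show "a * (if v j \<in> V then 1 else real n) \<le> norm (vec_dot (v j) x) \<and>
         norm (vec_dot (v j) x) \<le> b * (if v j \<in> V then 1 else real n) \<and>
         norm (vec_dot (v j) x - 0) \<le> b * (if v j \<in> V then 1 else real n)"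
        using est[OF n j, of "\<rho> *\<^sub>R q" x] Q(3)[OF q(1)] by (simp add: linear_scale[OF linear_vec_dot])
    qed (use n1 in auto)
    also have "(\<Prod>j=1..N. (if v j \<in> V then 1 else real n) powr lam j *
        (if v j \<in> V then 1 else real n) powr (CARD('k) * enn2real (1 / p j)))
      = real n powr (\<Sum>j | j \<in> {1..N} \<and> v j \<notin> V. t j)"
      using prod_if_powr[of "{1..N}" "real n" "\<lambda>j. v j \<in> V" t] n1 by (simp add: t_def powr_add)
    finally show "c0 * real n powr real ((CARD('m) - dim V) * CARD('k))
        \<le> annuli_const a b * real n powr (\<Sum>j | j \<in> {1..N} \<and> v j \<notin> V. t j)"
      using c0 n1 by (simp add: ennreal_le_iff2 mult_le_0_iff)
  qed
  also have "(\<Sum>j | j \<in> {1..N} \<and> v j \<notin> V. t j)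
    = (\<Sum>j | j \<in> {1..N} \<and> v j \<notin> V. enn2real (1 / p j) + lam j / real CARD('k)) * CARD('k)"
    by (simp only: t_def sum_scaled_exponents)
  finally have "real (CARD('m) - dim V) \<le> (\<Sum>j | j \<in> {1..N} \<and> v j \<notin> V. enn2real (1 / p j) + lam j / real CARD('k))"
    by simp
  \<comment> \<open>The truncated difference of natural numbers is never below the real
    difference.\<close>
  then show ?thesis by linarith
qed

section \<open>Condition (i): scaling\<close>

text \<open>For \<open>V = UNIV\<close> every \<open>v j\<close> belongs to \<open>V\<close>, so all
  annuli of an adapted ball have scale 1; a single ball at \<open>n0\<close> with zero displacement
  suffices.\<close>

lemma ex_nondegenerate_ball:
  obtains a b \<epsilon> :: real and y :: "(real ^ 'k) ^ 'm" where "0 < a" "a \<le> b" "0 < \<epsilon>"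
    "\<forall>x\<in>cball y \<epsilon>. \<forall>j\<in>{1..N}. a \<le> norm (vec_dot (v j) x) \<and> norm (vec_dot (v j) x) \<le> b"
proof -
  obtain a b \<epsilon> n0 P where adapted: "adapted_balls UNIV a b \<epsilon> n0 P"
    by (rule ex_adapted_balls[OF subspace_UNIV])
  then have ab: "0 < a" "a \<le> b" and \<epsilon>: "0 < \<epsilon>" and n0: "1 \<le> n0"
    by (simp_all add: adapted_balls_def)
  note est = adapted[unfolded adapted_balls_def, THEN conjunct2, THEN conjunct2, THEN conjunct2, THEN conjunct2,
      rule_format]
  show thesis
  proof (rule that[OF ab \<epsilon>])
    show "\<forall>x\<in>cball (P n0) \<epsilon>. \<forall>j\<in>{1..N}. a \<le> norm (vec_dot (v j) x) \<and> norm (vec_dot (v j) x) \<le> b"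
    proof (intro ballI)
      fix x j assume "x \<in> cball (P n0) \<epsilon>" "j \<in> {1..N}"
      then show "a \<le> norm (vec_dot (v j) x) \<and> norm (vec_dot (v j) x) \<le> b"
        using est[OF order_refl _ linear_0[OF linear_vec_dot], of j x] \<epsilon> by (simp add: dist_norm norm_minus_commute)
    qed
  qed
qed

text \<open>The lower bound is (iv) for the zero subspace, which contains no \<open>v j\<close>. For
  the upper bound, a nondegenerate ball is shrunk by \<open>1 / n\<close>: its volume decays like
  \<open>n powr - d\<close>, the right-hand side like \<open>n\<close> to minus the sum of the
  \<open>t j\<close>.\<close>

lemma sum_exponents_eq: "(\<Sum>j=1..N. enn2real (1 / p j) + lam j / real CARD('k)) = real CARD('m)"
proof (rule antisym)
  have "(\<Sum>j | j \<in> {1..N} \<and> v j \<notin> {0}. enn2real (1 / p j) + lam j / real CARD('k))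
     = (\<Sum>j=1..N. enn2real (1 / p j) + lam j / real CARD('k))"
    using nonzero by (intro sum.cong) auto
  then show "real CARD('m) \<le> (\<Sum>j=1..N. enn2real (1 / p j) + lam j / real CARD('k))"
    using sum_exponents_ge[of "{0}"] by simp
next
  obtain a b \<epsilon> :: real and y :: "(real ^ 'k) ^ 'm" where ab: "0 < a" "a \<le> b" and \<epsilon>: "0 < \<epsilon>"
    and est: "\<forall>x\<in>cball y \<epsilon>. \<forall>j\<in>{1..N}. a \<le> norm (vec_dot (v j) x) \<and> norm (vec_dot (v j) x) \<le> b"
    by (rule ex_nondegenerate_ball)
  note K = emeasure_le_of_annuli[OF ab]
  define d where "d = CARD('m) * CARD('k)"
  define c0 where "c0 = unit_ball_vol (real d) * \<epsilon> ^ d"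
  have c0: "0 < c0" using \<epsilon> unfolding c0_def by simp
  define t where "t j = lam j + CARD('k) * enn2real (1 / p j)" for j
  have "- real d \<le> - (\<Sum>j=1..N. t j)"
  proof (rule powr_le_imp_exponent_le[OF c0, of 1])
    fix n :: nat assume "1 \<le> n"
    then have n: "0 < real n" by simp
    have "\<epsilon> ^ d * real n powr - real d = (\<epsilon> / n) ^ d"
      using n by (simp add: powr_minus powr_realpow power_divide divide_inverse power_mult_distrib power_inverse)
    then have "ennreal (c0 * real n powr - real d) = emeasure lebesgue (ball (y /\<^sub>R real n) (\<epsilon> / n))"
      using \<epsilon> n by (subst emeasure_lebesgue_ball)
        (auto simp: c0_def mult.assoc mult.commute[of "real CARD('k)"] mult.commute[of "CARD('k)"] simp flip: d_def)
    also have "\<dots> \<le> ennreal (annuli_const a b * (\<Prod>j=1..N. (1 / real n) powr lam j *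
        (1 / real n) powr (CARD('k) * enn2real (1 / p j))))"
    proof (rule K[where c = "\<lambda>_. 0"])
      fix x j assume x: "x \<in> ball (y /\<^sub>R real n) (\<epsilon> / n)" and j: "j \<in> {1..N}"
      have "dist y (real n *\<^sub>R x) = norm (real n *\<^sub>R (x - y /\<^sub>R real n))"
        using n by (simp add: dist_norm norm_minus_commute[of y] scaleR_diff_right)
      also have "\<dots> = real n * norm (x - y /\<^sub>R real n)" by simp
      also have "\<dots> \<le> \<epsilon>" using x n by (simp add: dist_norm norm_minus_commute field_simps)
      finally show "a * (1 / real n) \<le> norm (vec_dot (v j) x) \<and>
         norm (vec_dot (v j) x) \<le> b * (1 / real n) \<and> norm (vec_dot (v j) x - 0) \<le> b * (1 / real n)"
        using est[rule_format, of "real n *\<^sub>R x" j] j n by (simp add: linear_scale[OF linear_vec_dot] field_simps)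
    qed (use n in auto)
    also have "(\<Prod>j=1..N. (1 / real n) powr lam j * (1 / real n) powr (CARD('k) * enn2real (1 / p j)))
      = real n powr - (\<Sum>j=1..N. t j)"
    proof -
      have "(\<Prod>j=1..N. (1 / real n) powr lam j * (1 / real n) powr (CARD('k) * enn2real (1 / p j)))
        = (\<Prod>j=1..N. real n powr - t j)"
        using n by (intro prod.cong) (simp_all only: t_def powr_minus_divide powr_add minus_add_distrib
          powr_divide powr_one_eq_one times_divide_times_eq mult_1)
      also have "\<dots> = real n powr (\<Sum>j=1..N. - t j)"
        using n by (simp add: powr_sum)
      finally show ?thesis by (simp only: sum_negf)
    qed
    finally show "c0 * real n powr - real d \<le> annuli_const a b * real n powr - (\<Sum>j=1..N. t j)"
      using c0 n by (simp add: ennreal_le_iff2 mult_le_0_iff)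
  qed
  moreover have "(\<Sum>j=1..N. t j) = (\<Sum>j=1..N. enn2real (1 / p j) + lam j / real CARD('k)) * CARD('k)"
    by (simp only: t_def sum_scaled_exponents)
  ultimately show "(\<Sum>j=1..N. enn2real (1 / p j) + lam j / real CARD('k)) \<le> real CARD('m)"
    by (simp add: d_def)
qed

section \<open>Condition (ii): superposition of many scales\<close>

text \<open>On \<open>M\<close> dyadic-like shells the functions \<open>f j\<close> are chosen so
  that, with the weight, they become \<open>g powr (1 / p j)\<close> for the scale-invariant density
  \<open>g\<close>. The integral of \<open>g\<close> is at most a multiple of \<open>M\<close>,
  while the \<open>M\<close> scales contribute equally to the form. Thus \<open>M\<close> is bounded
  by a multiple of \<open>M\<close> to the sum of the \<open>1 / p j\<close>.\<close>

lemma sum_inverse_exponents_ge: "1 \<le> (\<Sum>j=1..N. enn2real (1 / p j))"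
proof -
  obtain a b \<epsilon> :: real and y :: "(real ^ 'k) ^ 'm" where ab: "0 < a" "a \<le> b" and \<epsilon>: "0 < \<epsilon>"
    and est: "\<forall>x\<in>cball y \<epsilon>. \<forall>j\<in>{1..N}. a \<le> norm (vec_dot (v j) x) \<and> norm (vec_dot (v j) x) \<le> b"
    by (rule ex_nondegenerate_ball)
  have b: "0 < b" using ab by simp
  \<comment> \<open>For \<open>N = 0\<close> the sum in (i) would vanish, but the dimension is
    positive. The index 1 serves below to separate scales.\<close>
  have N: "1 \<in> {1..N}" using sum_exponents_eq by (cases "N = 0") auto
  \<comment> \<open>With this ratio the inner radius of the next shell is twice the outer radius of
    the present one.\<close>
  define D where "D = 2 * b / a"
  have Da: "D * a = 2 * b" and D: "2 \<le> D" using ab by (simp_all add: D_def field_simps)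
  have Dpos: "0 < D ^ i" for i using D by simp
  define \<omega> where "\<omega> = unit_ball_vol (real CARD('k))"
  have \<omega>: "0 < \<omega>" by (simp add: \<omega>_def)
  define d where "d = CARD('m) * CARD('k)"
  define q where "q j = enn2real (1 / p j)" for j
  define t where "t j = lam j + CARD('k) * q j" for j
  have "(\<Sum>j=1..N. t j) = (\<Sum>j=1..N. enn2real (1 / p j) + lam j / real CARD('k)) * CARD('k)"
    by (simp only: t_def q_def sum_scaled_exponents)
  then have sum_t: "(\<Sum>j=1..N. t j) = d" by (simp only: sum_exponents_eq d_def of_nat_mult)
  define shell where "shell i = {z :: real ^ 'k. a * D ^ i \<le> norm z} \<inter> cball 0 (b * D ^ i)" for i :: nat
  have shell_disj: "i = i'" if "z \<in> shell i" "z \<in> shell i'" for i i' z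
  proof -
    have False if "z \<in> shell i" "z \<in> shell i'" "i < i'" for i i'
    proof -
      have "D ^ Suc i \<le> D ^ i'" using that D by (intro power_increasing) auto
      then have "a * D ^ Suc i \<le> a * D ^ i'" using ab by simp
      also have "\<dots> \<le> b * D ^ i" using that by (auto simp: shell_def)
      finally have "(D * a) * D ^ i \<le> b * D ^ i" by (simp add: mult_ac)
      then show False using Dpos[of i] b by (simp add: Da)
    qed
    then show ?thesis using that by (metis linorder_neqE_nat)
  qed
  \<comment> \<open>Bounds the integral of \<open>g\<close> over one shell: the largest value of
    \<open>g\<close> times the volume of the enclosing ball, where the powers of
    \<open>D ^ i\<close> cancel.\<close>
  define c1 where "c1 = \<omega> * (b / a) ^ CARD('k)"
  have c1: "0 < c1" using \<omega> ab b by (simp add: c1_def)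
  define c2 where "c2 = (\<Prod>j=1..N. min (a powr - t j) (b powr - t j))"
  have c2: "0 < c2" unfolding c2_def using ab b by (intro prod_pos) auto
  define c3 where "c3 = c2 * (unit_ball_vol d * \<epsilon> ^ d)"
  have c3: "0 < c3" using c2 \<epsilon> by (simp add: c3_def)
  show ?thesis
  proof (rule powr_le_imp_exponent_le[OF c3, of 1])
    fix M :: nat assume "1 \<le> M"
    then have M: "0 < real M" by simp
    define S where "S = (\<Union>i<M. shell i)"
    have "closed (shell i)" for i
      unfolding shell_def by (intro closed_Int closed_Collect_le continuous_intros closed_cball)
    then have S: "S \<in> sets borel" unfolding S_def by (intro sets.finite_UN) auto
    define f where "f j z = norm z powr - t j * indicator S z" for j and z :: "real ^ 'k"
    define g where "g z = norm z powr - real CARD('k) * indicator S z" for z :: "real ^ 'k"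
    have int_g: "(\<integral>\<^sup>+z. ennreal (g z) \<partial>lebesgue) \<le> ennreal (real M * c1)"
    proof -
      have "(\<integral>\<^sup>+z. ennreal (g z) \<partial>lebesgue)
        \<le> (\<integral>\<^sup>+z. (\<Sum>i<M. ennreal ((a * D ^ i) powr - real CARD('k)) * indicator (cball (0 :: real ^ 'k) (b * D ^ i)) z) \<partial>lebesgue)"
      proof (rule nn_integral_mono)
        fix z
        show "ennreal (g z) \<le> (\<Sum>i<M. ennreal ((a * D ^ i) powr - real CARD('k)) * indicator (cball (0 :: real ^ 'k) (b * D ^ i)) z)"
        proof (cases "z \<in> S")
          case True
          then obtain i where i: "i < M" "z \<in> shell i" by (auto simp: S_def)
          have "ennreal (g z) \<le> ennreal ((a * D ^ i) powr - real CARD('k)) * indicator (cball (0 :: real ^ 'k) (b * D ^ i)) z"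
            using i True ab Dpos[of i]
            by (auto simp: g_def shell_def intro!: ennreal_leI powr_mono2')
          also have "\<dots> \<le> (\<Sum>i<M. ennreal ((a * D ^ i) powr - real CARD('k)) * indicator (cball (0 :: real ^ 'k) (b * D ^ i)) z)"
            using i by (intro member_le_sum) auto
          finally show ?thesis .
        qed (simp add: g_def)
      qed
      also have "\<dots> = (\<Sum>i<M. \<integral>\<^sup>+z. ennreal ((a * D ^ i) powr - real CARD('k)) * indicator (cball (0 :: real ^ 'k) (b * D ^ i)) z \<partial>lebesgue)"
        by (intro nn_integral_sum borel_measurable_times_ennreal borel_measurable_const borel_measurable_indicator) simp
      also have "\<dots> = (\<Sum>i<M. ennreal c1)"
      proof (rule sum.cong[OF refl])
        fix i
        have "(\<integral>\<^sup>+z. ennreal ((a * D ^ i) powr - real CARD('k)) * indicator (cball (0 :: real ^ 'k) (b * D ^ i)) z \<partial>lebesgue)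
          = ennreal ((a * D ^ i) powr - real CARD('k)) * emeasure lebesgue (cball (0 :: real ^ 'k) (b * D ^ i))"
          by (rule nn_integral_cmult_indicator) simp
        also have "\<dots> = ennreal ((a * D ^ i) powr - real CARD('k) * (\<omega> * (b * D ^ i) ^ CARD('k)))"
          using b Dpos[of i] \<omega> by (subst emeasure_lebesgue_ball) (auto simp: \<omega>_def ennreal_mult)
        also have "(a * D ^ i) powr - real CARD('k) * (\<omega> * (b * D ^ i) ^ CARD('k)) = c1"
          using ab D Dpos[of i] by (simp add: c1_def powr_minus powr_realpow power_mult_distrib power_divide field_simps)
        finally show "(\<integral>\<^sup>+z. ennreal ((a * D ^ i) powr - real CARD('k)) * indicator (cball (0 :: real ^ 'k) (b * D ^ i)) z \<partial>lebesgue)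
          = ennreal c1" .
      qed
      also have "\<dots> = ennreal (real M * c1)"
        using c1 by (simp add: ennreal_mult ennreal_of_nat_eq_real_of_nat)
      finally show ?thesis .
    qed
    \<comment> \<open>Dilates of the nondegenerate ball, which every \<open>v j\<close> maps into
      the shell of the same index.\<close>
    define T where "T i = ball (D ^ i *\<^sub>R y) (D ^ i * \<epsilon>)" for i
    have T_shell: "vec_dot (v j) x \<in> shell i" if "x \<in> T i" "j \<in> {1..N}" for i x j
    proof -
      have "dist y (x /\<^sub>R D ^ i) * D ^ i = dist (D ^ i *\<^sub>R y) x"
      proof -
        have "dist (D ^ i *\<^sub>R y) x = norm (D ^ i *\<^sub>R (y - x /\<^sub>R D ^ i))"
          using D by (simp add: dist_norm scaleR_diff_right)
        then show ?thesis using Dpos[of i] by (simp add: dist_norm)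
      qed
      also have "\<dots> \<le> \<epsilon> * D ^ i" using that by (simp add: T_def mult.commute)
      finally have "x /\<^sub>R D ^ i \<in> cball y \<epsilon>" using Dpos[of i] by simp
      then show ?thesis using est[rule_format, of "x /\<^sub>R D ^ i" j] that(2) Dpos[of i]
        by (simp add: linear_scale[OF linear_vec_dot] shell_def field_simps)
    qed
    have "ennreal (c3 * real M powr 1) = (\<Sum>i<M. ennreal c3)"
      using c3 M by (simp add: ennreal_mult ennreal_of_nat_eq_real_of_nat mult.commute)
    also have "\<dots> = (\<Sum>i<M. \<integral>\<^sup>+x. ennreal (c2 * (D ^ i) powr - real d) * indicator (T i) x \<partial>lebesgue)"
    proof (rule sum.cong[OF refl])
      fix i
      have "(\<integral>\<^sup>+x. ennreal (c2 * (D ^ i) powr - real d) * indicator (T i) x \<partial>lebesgue)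
        = ennreal (c2 * (D ^ i) powr - real d) * emeasure lebesgue (T i)"
        by (rule nn_integral_cmult_indicator) (simp add: T_def)
      also have "emeasure lebesgue (T i) = ennreal (unit_ball_vol (real d) * (D ^ i * \<epsilon>) ^ d)"
        unfolding T_def using Dpos[of i] \<epsilon>
        by (subst emeasure_lebesgue_ball)
          (auto simp: mult.assoc mult.commute[of "real CARD('k)"] mult.commute[of "CARD('k)"] simp flip: d_def)
      also have "ennreal (c2 * (D ^ i) powr - real d) * \<dots>
          = ennreal ((c2 * (D ^ i) powr - real d) * (unit_ball_vol (real d) * (D ^ i * \<epsilon>) ^ d))"
        using c2 by (simp add: ennreal_mult')
      also have "(c2 * (D ^ i) powr - real d) * (unit_ball_vol (real d) * (D ^ i * \<epsilon>) ^ d) = c3"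
        using D Dpos[of i] by (simp add: c3_def powr_minus powr_realpow power_mult_distrib field_simps)
      finally show "ennreal c3 = (\<integral>\<^sup>+x. ennreal (c2 * (D ^ i) powr - real d) * indicator (T i) x \<partial>lebesgue)" ..
    qed
    also have "\<dots> = (\<integral>\<^sup>+x. (\<Sum>i<M. ennreal (c2 * (D ^ i) powr - real d) * indicator (T i) x) \<partial>lebesgue)"
      unfolding T_def
      by (intro nn_integral_sum[symmetric] borel_measurable_times_ennreal borel_measurable_const
          borel_measurable_indicator) simp
    also have "\<dots> \<le> Lambda_form N v f"
      unfolding Lambda_form_def
    proof (rule nn_integral_mono)
      fix x
      show "(\<Sum>i<M. ennreal (c2 * (D ^ i) powr - real d) * indicator (T i) x)
        \<le> ennreal (\<Prod>j=1..N. f j (vec_dot (v j) x))"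
      proof (cases "\<exists>i<M. x \<in> T i")
        case True
        then obtain i where i: "i < M" "x \<in> T i" by blast
        \<comment> \<open>Otherwise \<open>vec_dot (v 1) x\<close> would lie in two different
          shells.\<close>
        have "x \<notin> T i'" if "i' \<noteq> i" for i'
          using that shell_disj[OF T_shell[OF _ N] T_shell[OF i(2) N]] by blast
        then have "(\<Sum>i'<M. ennreal (c2 * (D ^ i') powr - real d) * indicator (T i') x)
          = (\<Sum>i'<M. if i' = i then ennreal (c2 * (D ^ i) powr - real d) else 0)"
          using i(2) by (intro sum.cong) (auto simp: indicator_def)
        also have "\<dots> = ennreal (c2 * (D ^ i) powr - real d)" using i(1) by simp
        also have "\<dots> \<le> ennreal (\<Prod>j=1..N. f j (vec_dot (v j) x))"
        proof (rule ennreal_leI)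
          \<comment> \<open>Here (i) enters: the exponents \<open>t j\<close> add up to
            \<open>d\<close>, so the decay of the product exactly offsets the volume growth of
            \<open>T i\<close>.\<close>
          have "c2 * (D ^ i) powr - real d = (\<Prod>j=1..N. min (a powr - t j) (b powr - t j) * (D ^ i) powr - t j)"
          proof -
            have "(D ^ i) powr (\<Sum>j=1..N. - t j) = (\<Prod>j=1..N. (D ^ i) powr - t j)"
              using D by (intro powr_sum) auto
            then show ?thesis by (simp only: sum_negf sum_t c2_def prod.distrib)
          qed
          also have "\<dots> \<le> (\<Prod>j=1..N. f j (vec_dot (v j) x))"
          proof (intro prod_mono conjI)
            fix j assume j: "j \<in> {1..N}"
            show "0 \<le> min (a powr - t j) (b powr - t j) * (D ^ i) powr - t j" by simp
            have sh: "vec_dot (v j) x \<in> shell i" by (rule T_shell[OF i(2) j])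
            then have "vec_dot (v j) x \<in> S" using i(1) by (auto simp: S_def)
            then show "min (a powr - t j) (b powr - t j) * (D ^ i) powr - t j \<le> f j (vec_dot (v j) x)"
              using powr_between(2)[OF ab(1) Dpos[of i], of "norm (vec_dot (v j) x)" b "- t j"] sh
              by (simp add: f_def shell_def)
          qed
          finally show "c2 * (D ^ i) powr - real d \<le> (\<Prod>j=1..N. f j (vec_dot (v j) x))" .
        qed
        finally show ?thesis .
      next
        case False
        then show ?thesis by (simp add: indicator_def)
      qed
    qed
    also have "\<dots> \<le> ennreal (C * (\<Prod>j=1..N. 1 * (real M * c1) powr enn2real (1 / p j)))"
    proof (rule Lambda_form_le[where g="\<lambda>_. g"])
      fix j z
      have [measurable]: "S \<in> sets borel" by (rule S)
      have "f j \<in> borel_measurable borel" "g \<in> borel_measurable borel"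
        unfolding f_def g_def by measurable
      then show "f j \<in> borel_measurable lebesgue" "g \<in> borel_measurable lebesgue"
        by (auto intro: measurable_completion)
      show "0 \<le> f j z" "0 \<le> g z" by (simp_all add: f_def g_def)
      show "(0::real) \<le> 1" by simp
      show "0 < real M * c1" using M c1 by simp
      \<comment> \<open>Equality on \<open>S\<close>, because
        \<open>lam j - t j = - CARD('k) * q j\<close>; off \<open>S\<close> both sides vanish, also
        when the exponent is 0, since \<open>0 powr 0 = 0\<close>.\<close>
      show "norm z powr lam j * f j z \<le> 1 * g z powr enn2real (1 / p j)"
        by (cases "z \<in> S") (auto simp: f_def g_def t_def q_def powr_powr simp flip: powr_add)
    qed (rule int_g)
    also have "C * (\<Prod>j=1..N. 1 * (real M * c1) powr enn2real (1 / p j))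
      = (C * (\<Prod>j=1..N. c1 powr q j)) * real M powr (\<Sum>j=1..N. q j)"
      using M c1 by (simp add: q_def powr_mult prod.distrib powr_sum)
    finally show "c3 * real M powr 1 \<le> (C * (\<Prod>j=1..N. c1 powr q j)) * real M powr (\<Sum>j=1..N. enn2real (1 / p j))"
      using c3 M by (simp add: ennreal_le_iff2 mult_le_0_iff q_def)
  qed
qed

end

theorem theorem1p8:
  fixes N :: nat
    and v :: "nat \<Rightarrow> real ^ 'm"
    and p :: "nat \<Rightarrow> ennreal"
    and lam :: "nat \<Rightarrow> real"
  assumes distinct: "inj_on v {1..N}"
    and nonzero: "\<And>j. j \<in> {1..N} \<Longrightarrow> v j \<noteq> 0"
    and noncollinear:
      "\<And>i j. i \<in> {1..N} \<Longrightarrow> j \<in> {1..N} \<Longrightarrow> i \<noteq> j \<Longrightarrow> \<not> collinear {0, v i, v j}"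
    and exponents: "\<And>j. j \<in> {1..N} \<Longrightarrow> 1 \<le> p j"
    and bound: "\<exists>C::ennreal. C < \<infinity> \<and>
      (\<forall>f :: nat \<Rightarrow> real ^ 'k \<Rightarrow> real.
         (\<forall>j\<in>{1..N}. f j \<in> borel_measurable lebesgue \<and> (\<forall>x. 0 \<le> f j x)) \<longrightarrow>
         Lambda_form N v f \<le> C * (\<Prod>j=1..N. weighted_Lp_norm (p j) (lam j) (f j)))"
  shows "(\<Sum>j=1..N. enn2real (1 / p j) + lam j / real CARD('k)) = real CARD('m)
    \<and> (\<Sum>j=1..N. enn2real (1 / p j)) \<ge> 1
    \<and> (\<forall>V :: (real ^ 'm) set. subspace V \<longrightarrow>
         (\<Sum>j | j \<in> {1..N} \<and> v j \<notin> V. lam j) \<ge> 0)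
    \<and> (\<forall>V :: (real ^ 'm) set. subspace V \<longrightarrow>
         (\<Sum>j | j \<in> {1..N} \<and> v j \<notin> V. enn2real (1 / p j) + lam j / real CARD('k))
           \<ge> real CARD('m) - real (dim V))"
proof -
  obtain C0 :: ennreal where C0: "C0 < \<infinity>" "\<And>f :: nat \<Rightarrow> real ^ 'k \<Rightarrow> real.
      \<forall>j\<in>{1..N}. f j \<in> borel_measurable lebesgue \<and> (\<forall>x. 0 \<le> f j x) \<Longrightarrow>
      Lambda_form N v f \<le> C0 * (\<Prod>j=1..N. weighted_Lp_norm (p j) (lam j) (f j))"
    using bound by blast
  \<comment> \<open>\<open>C0\<close> is finite, so passing to the real constant loses
    nothing.\<close>
  interpret bounded_form N v p lam "enn2real C0" "TYPE('k)"
    using nonzero exponents C0 by unfold_locales (auto simp: less_top)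
  show ?thesis
    using sum_exponents_eq sum_inverse_exponents_ge sum_lam_nonneg sum_exponents_ge by blast
qed

end
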